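(* For any graph $\mathcal{G}$ (simple and connected), there exists $\beta_+>0$ such that if $\beta>\beta_+$, the mixing time of the Attracting Random Walks (ARW) model on $\mathcal{G}$ with $n$ particles and parameter $\beta$ is $\exp(\Omega(n))$.
   Context: ARW model: let $\mathcal{G}=(\mathcal{V},\mathcal{E})$ be a simple connected graph with $k=|\mathcal{V}|$ vertices; write $i\sim j$ if $(i,j)\in\mathcal{E}$. A configuration $x$ of $n$ indistinguishable particles assigns to each vertex $i$ the number $x(i)$ of particles at $i$, with $\sum_i x(i)=n$; let $\Omega$ be the set of configurations. For a fixed parameter $\beta$, one step of the Markov chain from $x$ is: choose one of the $n$ particles uniformly at random and let $i$ be its location; move it to a vertex $j\sim i$, $j\ne i$, with probability $\frac1Z\exp(\frac{\beta}{n}x(j))$, or keep it at $i$ with probability $\frac1Z\exp(\frac{\beta}{n}(x(i)-1))$, where $Z=\sum_{l\sim i}\exp(\frac{\beta}{n}x(l))+\exp(\frac{\beta}{n}(x(i)-1))$. Let $P$ be the transition matrix and $\pi$ the stationary distribution. Mixing time: $d(X,t)=\max_{x\in\Omega}\|P^t(x,\cdot)-\pi\|_{\mathrm{TV}}$, where $\|\cdot\|_{\mathrm{TV}}$ is total variation distance, and the mixing time is $t_{\mathrm{mix}}(X,\epsilon)=\min\{t: d(X,t)\le\epsilon\}$. The theorem does not specify $\epsilon$. The asymptotic notation refers to $n\to\infty$ with $\mathcal{G}$ and $\beta$ fixed.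
   Formalization: The graph is assumed to have at least two vertices, since on a one-vertex graph there is a single configuration and the mixing time is 0; the unspecified ε is taken to be any fixed value with 0 < ε < 1/2. *)

theory Defs
  imports "HOL-Probability.Probability" "Graph_Theory.Graph_Theory"
begin

section \<open>Mixing times of finite Markov chains\<close>

text \<open>A transition matrix is a kernel \<open>K :: 's \<Rightarrow> 's pmf\<close>, with \<open>P(x,y) = pmf (K x) y\<close>.\<close>

primrec kernel_power :: "('s \<Rightarrow> 's pmf) \<Rightarrow> nat \<Rightarrow> 's \<Rightarrow> 's pmf" where
  "kernel_power K 0 x = return_pmf x"
| "kernel_power K (Suc t) x = bind_pmf (kernel_power K t x) K"

definition tv_dist :: "'s pmf \<Rightarrow> 's pmf \<Rightarrow> real" where
  "tv_dist p q = (SUP A. \<bar>measure_pmf.prob p A - measure_pmf.prob q A\<bar>)"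

definition is_stationary :: "'s set \<Rightarrow> ('s \<Rightarrow> 's pmf) \<Rightarrow> 's pmf \<Rightarrow> bool" where
  "is_stationary S K p \<longleftrightarrow> set_pmf p \<subseteq> S \<and> bind_pmf p K = p"

text \<open>
  The following three notions are meant for kernels on a finite nonempty state space \<open>S\<close> that
  are irreducible (the stationary distribution is then unique) and aperiodic (the set of times
  in \<open>mixing_time\<close> is then nonempty for \<open>\<epsilon> > 0\<close>).
\<close>

definition stationary_dist :: "'s set \<Rightarrow> ('s \<Rightarrow> 's pmf) \<Rightarrow> 's pmf" where
  "stationary_dist S K = (THE p. is_stationary S K p)"

definition mixing_dist :: "'s set \<Rightarrow> ('s \<Rightarrow> 's pmf) \<Rightarrow> nat \<Rightarrow> real" where
  "mixing_dist S K t = Max ((\<lambda>x. tv_dist (kernel_power K t x) (stationary_dist S K)) ` S)"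

definition mixing_time :: "'s set \<Rightarrow> ('s \<Rightarrow> 's pmf) \<Rightarrow> real \<Rightarrow> nat" where
  "mixing_time S K \<epsilon> = (LEAST t. mixing_dist S K t \<le> \<epsilon>)"


section \<open>Attracting random walks\<close>

text \<open>
  Simple graphs are finite symmetric loop-free sets of ordered pairs (\<open>pair_graph\<close>).
  A configuration \<open>x\<close> of \<open>n\<close> indistinguishable particles is a multiset of \<open>n\<close> vertices:
  \<open>x(i)\<close> is \<open>count x i\<close> and \<open>n\<close> is \<open>size x\<close>.
\<close>

definition arw_configs :: "'a pair_pre_digraph \<Rightarrow> nat \<Rightarrow> 'a multiset set" where
  "arw_configs G n = multisets_of_size (pverts G) n"

definition arw_weight ::
  "'a pair_pre_digraph \<Rightarrow> real \<Rightarrow> 'a multiset \<Rightarrow> 'a \<Rightarrow> 'a \<Rightarrow> real" where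
  "arw_weight G \<beta> x i j =
     (if j = i then exp (\<beta> / real (size x) * (real (count x i) - 1))
      else if (i, j) \<in> parcs G then exp (\<beta> / real (size x) * real (count x j))
      else 0)"

definition arw_Z :: "'a pair_pre_digraph \<Rightarrow> real \<Rightarrow> 'a multiset \<Rightarrow> 'a \<Rightarrow> real" where
  "arw_Z G \<beta> x i =
     (\<Sum>l\<in>{l. (i, l) \<in> parcs G}. exp (\<beta> / real (size x) * real (count x l)))
     + exp (\<beta> / real (size x) * (real (count x i) - 1))"

definition arw_move ::
  "'a pair_pre_digraph \<Rightarrow> real \<Rightarrow> 'a multiset \<Rightarrow> 'a \<Rightarrow> 'a pmf" where
  "arw_move G \<beta> x i = embed_pmf (\<lambda>j. arw_weight G \<beta> x i j / arw_Z G \<beta> x i)"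

text \<open>
  Choosing a particle uniformly at random and looking at its location \<open>i\<close> amounts to sampling
  from \<open>pmf_of_multiset x\<close>, which gives \<open>i\<close> probability \<open>x(i)/n\<close>.
\<close>

definition arw_kernel ::
  "'a pair_pre_digraph \<Rightarrow> real \<Rightarrow> 'a multiset \<Rightarrow> 'a multiset pmf" where
  "arw_kernel G \<beta> x =
     do {
       i \<leftarrow> pmf_of_multiset x;
       j \<leftarrow> arw_move G \<beta> x i;
       return_pmf (x - {#i#} + {#j#})
     }"

definition arw_mixing_time :: "'a pair_pre_digraph \<Rightarrow> real \<Rightarrow> nat \<Rightarrow> real \<Rightarrow> nat" where
  "arw_mixing_time G \<beta> n \<epsilon> = mixing_time (arw_configs G n) (arw_kernel G \<beta>) \<epsilon>"

text \<open>The weights are normalised, so \<open>embed_pmf\<close> yields the intended distribution.\<close>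

lemma pmf_arw_move:
  assumes "pair_graph G"
  shows "pmf (arw_move G \<beta> x i) j = arw_weight G \<beta> x i j / arw_Z G \<beta> x i"
proof -
  interpret pair_graph G by fact
  let ?N = "{l. (i, l) \<in> parcs G}"
  have fin: "finite ?N"
    by (rule finite_surj[OF pair_finite_arcs, of _ snd]) force
  have i: "i \<notin> ?N"
    using pair_no_loops by force
  have pos: "arw_Z G \<beta> x i > 0"
    unfolding arw_Z_def by (intro add_nonneg_pos sum_nonneg) auto
  have nonneg: "0 \<le> arw_weight G \<beta> x i j / arw_Z G \<beta> x i" for j
    using pos by (simp add: arw_weight_def)
  have "(\<Sum>j\<in>?N. arw_weight G \<beta> x i j)
        = (\<Sum>l\<in>?N. exp (\<beta> / real (size x) * real (count x l)))"
    using i by (intro sum.cong) (auto simp: arw_weight_def)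
  then have sum: "(\<Sum>j\<in>insert i ?N. arw_weight G \<beta> x i j) = arw_Z G \<beta> x i"
    using fin i by (simp add: arw_Z_def arw_weight_def)
  have "(\<integral>\<^sup>+ j. ennreal (arw_weight G \<beta> x i j / arw_Z G \<beta> x i) \<partial>count_space UNIV)
        = (\<Sum>j\<in>insert i ?N. ennreal (arw_weight G \<beta> x i j / arw_Z G \<beta> x i))"
    using fin by (intro nn_integral_count_space') (auto simp: arw_weight_def)
  also have "\<dots> = ennreal (\<Sum>j\<in>insert i ?N. arw_weight G \<beta> x i j / arw_Z G \<beta> x i)"
    using nonneg by (intro sum_ennreal)
  also have "\<dots> = 1"
    using pos by (simp only: sum flip: sum_divide_distrib) simp
  finally show ?thesis
    unfolding arw_move_def by (intro pmf_embed_pmf nonneg)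
qed

end

theory Submission
  imports Defs "HOL-Real_Asymp.Real_Asymp"
begin

text \<open>
  For every vertex \<open>v\<close> the chain started from \<open>n\<close> particles at \<open>v\<close> keeps more than half of them at \<open>v\<close>
  for a time exponential in \<open>n\<close>. For two different vertices these events are disjoint, so the
  stationary distribution gives one of them probability at most \<open>1/2\<close>, and the chain started there is
  not mixed before it leaves the event.

  Metastability at \<open>v\<close>: let \<open>F(x)\<close> be the sum of \<open>1 - a^d(i,v)\<close> over all particles, \<open>i\<close> being the location of
  the particle and \<open>d\<close> the graph distance. As long as at most \<open>n/\<beta>\<close> particles are away from \<open>v\<close>, a selected
  particle outside \<open>v\<close> approaches \<open>v\<close> with a probability bounded below independently of \<open>\<beta>\<close>, so that for
  small \<open>a\<close> its contribution decreases on average, while a particle at \<open>v\<close> leaves with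
  probability at most of order \<open>exp (-\<beta>)\<close>. Hence, for large \<open>\<beta>\<close>, \<open>F\<close> has negative drift while it is between \<open>n/(4\<beta>)\<close> and
  \<open>n/(2\<beta>)\<close>, and an exponential supermartingale estimate shows that it stays below the upper level for
  exponentially many steps.

  As the mixing time is a \<open>LEAST\<close>, its lower bound also needs that the chain mixes at all. This
  follows from irreducibility and laziness by Doeblin's contraction argument.
\<close>

section \<open>Convergence of finite Markov chains\<close>

lemma kernel_power_add: "kernel_power K (s + t) x = bind_pmf (kernel_power K s x) (kernel_power K t)"
  by (induction t) (simp_all add: bind_return_pmf' bind_assoc_pmf)

lemma set_pmf_kernel_power_subset:
  assumes "\<And>x. x \<in> S \<Longrightarrow> set_pmf (K x) \<subseteq> S" "x \<in> S"
  shows "set_pmf (kernel_power K t x) \<subseteq> S"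
  using assms by (induction t) auto

text \<open>A lazy chain can wait, so supports only grow in time. This turns the separate hitting
  times of an irreducible chain into one common time at which all transitions have positive
  probability.\<close>

lemma set_pmf_kernel_power_mono:
  assumes "\<And>x. x \<in> S \<Longrightarrow> set_pmf (K x) \<subseteq> S" "\<And>x. x \<in> S \<Longrightarrow> x \<in> set_pmf (K x)"
    and "x \<in> S" "s \<le> t"
  shows "set_pmf (kernel_power K s x) \<subseteq> set_pmf (kernel_power K t x)"
proof -
  have *: "set_pmf (kernel_power K t x) \<subseteq> set_pmf (kernel_power K (Suc t) x)" for t
    using assms(2) set_pmf_kernel_power_subset[OF assms(1,3)] by fastforce
  show ?thesis
    using \<open>s \<le> t\<close> by (rule lift_Suc_mono_le[where f = "\<lambda>t. set_pmf (kernel_power K t x)", OF *])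
qed

lemma rtrancl_imp_kernel_power:
  assumes "(x, y) \<in> {(x, y). y \<in> set_pmf (K x)}\<^sup>*"
  shows "\<exists>t. y \<in> set_pmf (kernel_power K t x)"
  using assms
proof (induction rule: rtrancl_induct)
  case base
  have "x \<in> set_pmf (kernel_power K 0 x)" by simp
  then show ?case by blast
next
  case (step y z)
  then obtain t where "y \<in> set_pmf (kernel_power K t x)" by blast
  with step have "z \<in> set_pmf (kernel_power K (Suc t) x)" by auto
  then show ?case by blast
qed

lemma pmf_bind_eq_sum:
  assumes "finite S" "set_pmf p \<subseteq> S"
  shows "pmf (bind_pmf p K) y = (\<Sum>z\<in>S. pmf p z * pmf (K z) y)"
  using assms by (subst pmf_bind, subst integral_measure_pmf[of S]) auto

section \<open>Total variation distance on finite supports\<close>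

lemma abs_prob_diff_le_tv_dist:
  "\<bar>measure_pmf.prob p A - measure_pmf.prob q A\<bar> \<le> tv_dist p q"
  unfolding tv_dist_def
proof (rule cSUP_upper)
  have "\<bar>measure_pmf.prob p B - measure_pmf.prob q B\<bar> \<le> 1" for B
    using measure_pmf.prob_le_1[of p B] measure_pmf.prob_le_1[of q B]
      measure_nonneg[of p B] measure_nonneg[of q B] by linarith
  then show "bdd_above (range (\<lambda>A. \<bar>measure_pmf.prob p A - measure_pmf.prob q A\<bar>))"
    by (intro bdd_aboveI2[of _ _ 1])
qed auto

lemma tv_dist_le_sum:
  assumes S: "finite S" "set_pmf p \<subseteq> S" "set_pmf q \<subseteq> S"
  shows "tv_dist p q \<le> (\<Sum>y\<in>S. \<bar>pmf p y - pmf q y\<bar>)"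
  unfolding tv_dist_def
proof (rule cSUP_least)
  fix A
  have *: "measure_pmf.prob r A = (\<Sum>y\<in>S \<inter> A. pmf r y)" if "set_pmf r \<subseteq> S" for r
  proof -
    have "measure_pmf.prob r A = measure_pmf.prob r (S \<inter> A)"
      using that by (intro measure_pmf.finite_measure_eq_AE) (auto simp: AE_measure_pmf_iff)
    then show ?thesis using S by (simp add: measure_measure_pmf_finite)
  qed
  have "\<bar>measure_pmf.prob p A - measure_pmf.prob q A\<bar> = \<bar>\<Sum>y\<in>S \<inter> A. pmf p y - pmf q y\<bar>"
    using S by (simp add: * sum_subtractf)
  also have "\<dots> \<le> (\<Sum>y\<in>S \<inter> A. \<bar>pmf p y - pmf q y\<bar>)"
    by (rule sum_abs)
  also have "\<dots> \<le> (\<Sum>y\<in>S. \<bar>pmf p y - pmf q y\<bar>)"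
    using S by (intro sum_mono2) auto
  finally show "\<bar>measure_pmf.prob p A - measure_pmf.prob q A\<bar> \<le> (\<Sum>y\<in>S. \<bar>pmf p y - pmf q y\<bar>)" .
qed auto

section \<open>Geometric merging of the rows and convergence\<close>

text \<open>Doeblin's argument: a common minorisation \<open>d\<close> of the rows of \<open>P\<close> can be subtracted before
  comparing two averages, and only mass \<open>1 - d * card S\<close> remains.\<close>

lemma doeblin_contraction:
  fixes u :: "'s \<Rightarrow> real"
  assumes S: "finite S" and supp: "set_pmf p \<subseteq> S" "set_pmf q \<subseteq> S"
    and d: "\<And>z. z \<in> S \<Longrightarrow> d \<le> pmf p z" "\<And>z. z \<in> S \<Longrightarrow> d \<le> pmf q z"
    and osc: "\<And>x y. x \<in> S \<Longrightarrow> y \<in> S \<Longrightarrow> \<bar>u x - u y\<bar> \<le> c"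
  shows "\<bar>(\<Sum>z\<in>S. pmf p z * u z) - (\<Sum>z\<in>S. pmf q z * u z)\<bar> \<le> (1 - d * card S) * c"
proof -
  have "S \<noteq> {}" using supp(1) set_pmf_not_empty by fast
  define m where "m = Min (u ` S)"
  have "m \<in> u ` S" unfolding m_def using S \<open>S \<noteq> {}\<close> by (intro Min_in) auto
  then obtain y where y: "y \<in> S" "m = u y" by auto
  have m: "0 \<le> u z - m" "u z - m \<le> c" if "z \<in> S" for z
    using osc[OF that y(1)] y(2) S that Min_le[of "u ` S" "u z"] by (auto simp: m_def)
  have sum1: "(\<Sum>z\<in>S. pmf r z) = 1" if "set_pmf r \<subseteq> S" for r
    using S that by (rule sum_pmf_eq_1)
  \<comment> \<open>The same amount is removed from both averages, so \<open>a p - a q\<close> is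
    their difference. Measuring \<open>u\<close> from its minimum \<open>m\<close> keeps both terms
    between 0 and the bound.\<close>
  define a where "a r = (\<Sum>z\<in>S. (pmf r z - d) * (u z - m))" for r
  have a: "0 \<le> a r" "a r \<le> (1 - d * card S) * c"
    if "set_pmf r \<subseteq> S" "\<And>z. z \<in> S \<Longrightarrow> d \<le> pmf r z" for r
  proof -
    show "0 \<le> a r" unfolding a_def using that m by (intro sum_nonneg mult_nonneg_nonneg) auto
    have "a r \<le> (\<Sum>z\<in>S. (pmf r z - d) * c)"
      unfolding a_def using that m by (intro sum_mono mult_left_mono) auto
    also have "\<dots> = (1 - d * card S) * c"
      by (simp add: sum_distrib_right[symmetric] sum_subtractf sum1[OF that(1)])
    finally show "a r \<le> (1 - d * card S) * c" .
  qed
  have "a r = (\<Sum>z\<in>S. pmf r z * u z) - m - d * (\<Sum>z\<in>S. u z - m)" if "set_pmf r \<subseteq> S" for r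
  proof -
    have "a r = (\<Sum>z\<in>S. pmf r z * u z) - m * (\<Sum>z\<in>S. pmf r z) - d * (\<Sum>z\<in>S. u z - m)"
      unfolding a_def sum_distrib_left sum_subtractf[symmetric]
      by (intro sum.cong) (auto simp: algebra_simps)
    then show ?thesis using sum1[OF that] by simp
  qed
  then have "(\<Sum>z\<in>S. pmf p z * u z) - (\<Sum>z\<in>S. pmf q z * u z) = a p - a q"
    using supp by simp
  then show ?thesis
    using a[OF supp(1) d(1)] a[OF supp(2) d(2)] by linarith
qed

text \<open>Split off the first \<open>N\<close> steps: each row is an average of rows of the
  remaining power, whose oscillation is bounded by induction, and Doeblin's contraction adds one
  factor. The offset \<open>s\<close> takes the remainder of an arbitrary time modulo
  \<open>N\<close>.\<close>

lemma kernel_power_oscillation: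
  assumes S: "finite S" and cl: "\<And>x. x \<in> S \<Longrightarrow> set_pmf (K x) \<subseteq> S"
    and d: "\<And>x y. x \<in> S \<Longrightarrow> y \<in> S \<Longrightarrow> d \<le> pmf (kernel_power K N x) y"
    and x: "x \<in> S" "x' \<in> S"
  shows "\<bar>pmf (kernel_power K (s + m * N) x) y - pmf (kernel_power K (s + m * N) x') y\<bar>
           \<le> (1 - d * card S) ^ m"
  using x
proof (induction m arbitrary: x x')
  case 0
  have "\<bar>pmf p y - pmf q y\<bar> \<le> 1" for p q
    using pmf_nonneg[of p y] pmf_nonneg[of q y] pmf_le_1[of p y] pmf_le_1[of q y] by linarith
  then show ?case by simp
next
  case (Suc m)
  have supp: "set_pmf (kernel_power K N x) \<subseteq> S" if "x \<in> S" for x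
    using cl that by (rule set_pmf_kernel_power_subset)
  have "s + Suc m * N = N + (s + m * N)" by simp
  then have *: "pmf (kernel_power K (s + Suc m * N) x) y =
      (\<Sum>z\<in>S. pmf (kernel_power K N x) z * pmf (kernel_power K (s + m * N) z) y)" if "x \<in> S" for x
    using pmf_bind_eq_sum[OF S supp[OF that]]
    by (simp only: kernel_power_add[of K N])
  show ?case
    unfolding *[OF Suc.prems(1)] *[OF Suc.prems(2)] power_Suc
    using Suc S d by (intro doeblin_contraction supp) auto
qed

text \<open>The rows of the powers merge geometrically once some power is strictly positive, so they
  have a common limit. This limit is the unique stationary distribution, which gives the
  \<open>THE\<close> in \<open>stationary_dist\<close> its meaning; finiteness of \<open>S\<close>
  makes the convergence uniform in the starting state.\<close>

lemma ex_mixing_dist_le: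
  assumes S: "finite S" "S \<noteq> {}" and cl: "\<And>x. x \<in> S \<Longrightarrow> set_pmf (K x) \<subseteq> S"
    and lazy: "\<And>x. x \<in> S \<Longrightarrow> x \<in> set_pmf (K x)"
    and irred: "\<And>x y. x \<in> S \<Longrightarrow> y \<in> S \<Longrightarrow> (x, y) \<in> {(x, y). y \<in> set_pmf (K x)}\<^sup>*"
    and "0 < \<epsilon>"
  shows "\<exists>t. mixing_dist S K t \<le> \<epsilon>"
proof -
  have supp: "set_pmf (kernel_power K t x) \<subseteq> S" if "x \<in> S" for t x
    using cl that by (rule set_pmf_kernel_power_subset)
  obtain \<tau> where \<tau>: "\<And>x y. x \<in> S \<Longrightarrow> y \<in> S \<Longrightarrow> y \<in> set_pmf (kernel_power K (\<tau> x y) x)"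
    using rtrancl_imp_kernel_power[OF irred] by metis
  \<comment> \<open>\<open>Suc\<close> keeps \<open>N\<close> positive, so that
    \<open>t div N\<close> tends to infinity.\<close>
  define N where "N = Suc (Max ((\<lambda>(x, y). \<tau> x y) ` (S \<times> S)))"
  have "\<tau> x y \<le> N" if "x \<in> S" "y \<in> S" for x y
    unfolding N_def using S that by (intro le_SucI Max_ge) auto
  then have pos: "0 < pmf (kernel_power K N x) y" if "x \<in> S" "y \<in> S" for x y
    using \<tau> set_pmf_kernel_power_mono[OF cl lazy] that by (blast intro: pmf_positive)
  define d where "d = Min ((\<lambda>(x, y). pmf (kernel_power K N x) y) ` (S \<times> S))"
  have "d \<in> (\<lambda>(x, y). pmf (kernel_power K N x) y) ` (S \<times> S)"
    unfolding d_def using S by (intro Min_in) auto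
  then have "0 < d" using pos by auto
  have d: "d \<le> pmf (kernel_power K N x) y" if "x \<in> S" "y \<in> S" for x y
    unfolding d_def using S that by (intro Min_le) auto
  define r where "r = 1 - d * card S"
  have "r < 1" using S \<open>0 < d\<close> by (simp add: r_def card_gt_0_iff)
  obtain x0 where x0: "x0 \<in> S" using S by auto
  have "d * card S = (\<Sum>y\<in>S. d)" by simp
  also have "\<dots> \<le> (\<Sum>y\<in>S. pmf (kernel_power K N x0) y)"
    using d x0 by (intro sum_mono)
  also have "\<dots> = 1"
    using S supp x0 by (intro sum_pmf_eq_1)
  finally have "0 \<le> r" by (simp add: r_def)
  have lim_r: "(\<lambda>t. r ^ (t div N)) \<longlonglongrightarrow> 0"
  proof (rule LIMSEQ_power_zero[THEN filterlim_compose])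
    show "norm r < 1" using \<open>0 \<le> r\<close> \<open>r < 1\<close> by simp
    show "filterlim (\<lambda>t. t div N) sequentially sequentially"
      unfolding filterlim_at_top
    proof
      fix Z
      show "\<forall>\<^sub>F t in sequentially. Z \<le> t div N"
        using eventually_ge_at_top[of "Z * N"]
        by eventually_elim (simp add: N_def less_eq_div_iff_mult_less_eq)
    qed
  qed
  have osc: "\<bar>pmf (kernel_power K t x) y - pmf (kernel_power K t x') y\<bar> \<le> r ^ (t div N)"
    if "x \<in> S" "x' \<in> S" for t x x' y
    using kernel_power_oscillation[OF S(1) cl d that, of "t mod N" "t div N"] by (simp add: r_def)
  \<comment> \<open>The row of \<open>x\<close> at time \<open>s + t\<close> averages rows at time
    \<open>t\<close>, all within the oscillation bound of the row of \<open>x\<close>. For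
    \<open>x0\<close> this gives the Cauchy property.\<close>
  have step: "\<bar>pmf (kernel_power K (s + t) x) y - pmf (kernel_power K t x) y\<bar> \<le> r ^ (t div N)"
    if "x \<in> S" for s t x y
  proof -
    let ?p = "kernel_power K s x"
    have 1: "(\<Sum>z\<in>S. pmf ?p z) = 1" using S supp that by (intro sum_pmf_eq_1)
    have "pmf (kernel_power K (s + t) x) y - pmf (kernel_power K t x) y
      = (\<Sum>z\<in>S. pmf ?p z * pmf (kernel_power K t z) y) - (\<Sum>z\<in>S. pmf ?p z) * pmf (kernel_power K t x) y"
      unfolding 1 by (simp add: kernel_power_add[of K s] pmf_bind_eq_sum[OF S(1) supp[OF that]])
    also have "\<dots> = (\<Sum>z\<in>S. pmf ?p z * (pmf (kernel_power K t z) y - pmf (kernel_power K t x) y))"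
      by (simp add: sum_distrib_right right_diff_distrib sum_subtractf)
    also have "\<bar>\<dots>\<bar> \<le> (\<Sum>z\<in>S. pmf ?p z * r ^ (t div N))"
      using osc that
      by (intro order_trans[OF sum_abs] sum_mono) (auto simp: abs_mult intro!: mult_left_mono)
    also have "\<dots> = r ^ (t div N)" by (simp add: 1 flip: sum_distrib_right)
    finally show ?thesis .
  qed
  have "convergent (\<lambda>t. pmf (kernel_power K t x0) y)" for y
  proof (rule Cauchy_convergent, rule metric_CauchyI)
    fix e :: real assume "0 < e"
    then have "\<forall>\<^sub>F t in sequentially. r ^ (t div N) < e / 2"
      using order_tendstoD(2)[OF lim_r, of "e / 2"] by simp
    then obtain M where M: "r ^ (M div N) < e / 2"
      by (auto simp: eventually_sequentially)
    have *: "\<bar>pmf (kernel_power K t x0) y - pmf (kernel_power K M x0) y\<bar> < e / 2" if "M \<le> t" for t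
      using step[OF x0, of "t - M" M y] M that by simp
    have "dist (pmf (kernel_power K m x0) y) (pmf (kernel_power K n x0) y) < e" if "M \<le> m" "M \<le> n" for m n
      using *[OF that(1)] *[OF that(2)] unfolding dist_real_def by linarith
    then show "\<exists>M. \<forall>m\<ge>M. \<forall>n\<ge>M. dist (pmf (kernel_power K m x0) y) (pmf (kernel_power K n x0) y) < e"
      by blast
  qed
  then obtain f where f0: "\<And>y. (\<lambda>t. pmf (kernel_power K t x0) y) \<longlonglongrightarrow> f y"
    unfolding convergent_def by metis
  have f: "(\<lambda>t. pmf (kernel_power K t x) y) \<longlonglongrightarrow> f y" if "x \<in> S" for x y
  proof (rule Lim_transform[OF f0])
    show "(\<lambda>t. pmf (kernel_power K t x) y - pmf (kernel_power K t x0) y) \<longlonglongrightarrow> 0"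
      using osc[OF that x0] by (intro Lim_null_comparison[OF _ lim_r]) auto
  qed
  have f_nonneg: "0 \<le> f y" for y
    by (rule LIMSEQ_le_const[OF f0]) auto
  have f_out: "f y = 0" if "y \<notin> S" for y
  proof -
    have "(\<lambda>t. pmf (kernel_power K t x0) y) = (\<lambda>_. 0)"
    proof
      show "pmf (kernel_power K t x0) y = 0" for t
        using supp[OF x0, of t] that by (auto simp: pmf_eq_0_set_pmf)
    qed
    then show ?thesis using f0[of y] by (simp add: LIMSEQ_const_iff)
  qed
  have "(\<lambda>t. \<Sum>y\<in>S. pmf (kernel_power K t x0) y) \<longlonglongrightarrow> (\<Sum>y\<in>S. f y)"
    by (intro tendsto_sum f0)
  moreover have "(\<Sum>y\<in>S. pmf (kernel_power K t x0) y) = 1" for t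
    using S supp x0 by (intro sum_pmf_eq_1)
  ultimately have f_sum: "(\<Sum>y\<in>S. f y) = 1"
    by (simp add: LIMSEQ_const_iff)
  define p where "p = embed_pmf f"
  have "(\<integral>\<^sup>+ y. ennreal (f y) \<partial>count_space UNIV) = (\<Sum>y\<in>S. ennreal (f y))"
    using S f_out by (intro nn_integral_count_space') auto
  also have "\<dots> = 1" using f_nonneg f_sum by (simp add: sum_ennreal)
  finally have p: "pmf p y = f y" for y
    unfolding p_def by (intro pmf_embed_pmf f_nonneg)
  have p_supp: "set_pmf p \<subseteq> S"
    using f_out p by (force simp: set_pmf_iff)
  \<comment> \<open>Stationarity comes from letting \<open>t\<close> tend to infinity in one further
    step of the chain.\<close>
  have "bind_pmf p K = p"
  proof (rule pmf_eqI)
    fix y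
    have "(\<lambda>t. \<Sum>z\<in>S. pmf (kernel_power K t x0) z * pmf (K z) y) \<longlonglongrightarrow> (\<Sum>z\<in>S. f z * pmf (K z) y)"
      by (intro tendsto_intros f0)
    then have "(\<lambda>t. pmf (kernel_power K (Suc t) x0) y) \<longlonglongrightarrow> (\<Sum>z\<in>S. f z * pmf (K z) y)"
      by (simp add: pmf_bind_eq_sum[OF S(1) supp[OF x0]])
    moreover have "(\<lambda>t. pmf (kernel_power K (Suc t) x0) y) \<longlonglongrightarrow> f y"
      using f0[of y] by (rule LIMSEQ_Suc)
    ultimately have "(\<Sum>z\<in>S. f z * pmf (K z) y) = f y"
      by (rule LIMSEQ_unique)
    then show "pmf (bind_pmf p K) y = pmf p y"
      by (simp add: pmf_bind_eq_sum[OF S(1) p_supp] p)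
  qed
  then have "is_stationary S K p"
    using p_supp by (simp add: is_stationary_def)
  \<comment> \<open>A stationary \<open>q\<close> is an average of the rows at every time
    \<open>t\<close>, and all these rows tend to \<open>f\<close>.\<close>
  moreover have "q = p" if "is_stationary S K q" for q
  proof (rule pmf_eqI)
    fix y
    have q: "set_pmf q \<subseteq> S" "bind_pmf q K = q" using that by (auto simp: is_stationary_def)
    have inv: "bind_pmf q (\<lambda>x. kernel_power K t x) = q" for t
    proof (induction t)
      case (Suc t)
      have "bind_pmf q (\<lambda>x. kernel_power K (Suc t) x) = bind_pmf (bind_pmf q (\<lambda>x. kernel_power K t x)) K"
        by (simp add: bind_assoc_pmf)
      then show ?case using Suc q(2) by simp
    qed (simp add: bind_return_pmf')
    have "pmf q y = (\<Sum>z\<in>S. pmf q z * pmf (kernel_power K t z) y)" for t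
      using pmf_bind_eq_sum[OF S(1) q(1), of "kernel_power K t" y] by (simp add: inv)
    moreover have "(\<lambda>t. \<Sum>z\<in>S. pmf q z * pmf (kernel_power K t z) y) \<longlonglongrightarrow> (\<Sum>z\<in>S. pmf q z * f y)"
      by (intro tendsto_intros f)
    ultimately have "pmf q y = (\<Sum>z\<in>S. pmf q z * f y)"
      by (simp add: LIMSEQ_const_iff)
    also have "\<dots> = f y"
      using sum_pmf_eq_1[OF S(1) q(1)] by (simp flip: sum_distrib_right)
    finally show "pmf q y = pmf p y" by (simp add: p)
  qed
  ultimately have stat: "stationary_dist S K = p"
    unfolding stationary_dist_def by (intro the_equality)
  have "\<forall>\<^sub>F t in sequentially. (\<Sum>y\<in>S. \<bar>pmf (kernel_power K t x) y - pmf p y\<bar>) < \<epsilon>" if "x \<in> S" for x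
  proof (rule order_tendstoD(2)[OF _ \<open>0 < \<epsilon>\<close>])
    have "(\<lambda>t. \<Sum>y\<in>S. \<bar>pmf (kernel_power K t x) y - pmf p y\<bar>) \<longlonglongrightarrow> (\<Sum>y\<in>S. \<bar>f y - pmf p y\<bar>)"
      by (intro tendsto_intros f that)
    then show "(\<lambda>t. \<Sum>y\<in>S. \<bar>pmf (kernel_power K t x) y - pmf p y\<bar>) \<longlonglongrightarrow> 0"
      by (simp add: p)
  qed
  then have "\<forall>\<^sub>F t in sequentially. \<forall>x\<in>S. (\<Sum>y\<in>S. \<bar>pmf (kernel_power K t x) y - pmf p y\<bar>) < \<epsilon>"
    using S by (intro eventually_ball_finite) auto
  then obtain t where t: "\<forall>x\<in>S. (\<Sum>y\<in>S. \<bar>pmf (kernel_power K t x) y - pmf p y\<bar>) < \<epsilon>"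
    by (auto simp: eventually_sequentially)
  have "tv_dist (kernel_power K t x) p \<le> \<epsilon>" if "x \<in> S" for x
    using tv_dist_le_sum[OF S(1) supp[OF that] p_supp, of t] t that by fastforce
  then have "mixing_dist S K t \<le> \<epsilon>"
    unfolding mixing_dist_def stat using S by (intro Max.boundedI) auto
  then show ?thesis ..
qed

section \<open>Escape estimates from negative drift\<close>

lemma expectation_kernel_power_le:
  fixes W :: "'s \<Rightarrow> real"
  assumes S: "finite S" and cl: "\<And>x. x \<in> S \<Longrightarrow> set_pmf (K x) \<subseteq> S"
    and step: "\<And>x. x \<in> S \<Longrightarrow> measure_pmf.expectation (K x) W \<le> W x + C"
    and x0: "x0 \<in> S"
  shows "measure_pmf.expectation (kernel_power K t x0) W \<le> W x0 + real t * C"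
proof (induction t)
  case (Suc t)
  let ?p = "kernel_power K t x0"
  have supp: "set_pmf ?p \<subseteq> S" using cl x0 by (rule set_pmf_kernel_power_subset)
  have "measure_pmf.expectation (kernel_power K (Suc t) x0) W
      = (\<Sum>x\<in>S. pmf ?p x *\<^sub>R measure_pmf.expectation (K x) W)"
    unfolding kernel_power.simps
    by (intro pmf_expectation_bind supp S finite_subset[OF cl])
  also have "\<dots> \<le> (\<Sum>x\<in>S. pmf ?p x * (W x + C))"
    using step by (auto intro!: sum_mono mult_left_mono)
  also have "\<dots> = (\<Sum>x\<in>S. pmf ?p x * W x) + (\<Sum>x\<in>S. pmf ?p x) * C"
    by (simp add: distrib_left sum.distrib sum_distrib_right)
  also have "(\<Sum>x\<in>S. pmf ?p x) = 1"
    using S supp by (rule sum_pmf_eq_1)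
  also have "(\<Sum>x\<in>S. pmf ?p x * W x) = measure_pmf.expectation ?p W"
    using supp S by (subst integral_measure_pmf[of S]) auto
  finally show ?case using Suc.IH by (simp add: algebra_simps)
qed simp

text \<open>Truncating the exponential of \<open>F\<close> at level \<open>exp (\<theta> * L)\<close> makes its expectation grow by a bounded amount
  in every step, also from states beyond the level, so no stopping time is needed.\<close>

lemma prob_kernel_power_ge_le:
  fixes F :: "'s \<Rightarrow> real"
  assumes S: "finite S" and cl: "\<And>x. x \<in> S \<Longrightarrow> set_pmf (K x) \<subseteq> S"
    and incr: "\<And>x y. x \<in> S \<Longrightarrow> y \<in> set_pmf (K x) \<Longrightarrow> F y \<le> F x + 1"
    and drift: "\<And>x. x \<in> S \<Longrightarrow> L / 2 \<le> F x \<Longrightarrow> F x \<le> L \<Longrightarrow>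
      measure_pmf.expectation (K x) (\<lambda>y. exp (\<theta> * F y)) \<le> exp (\<theta> * F x)"
    and "0 < \<theta>" "0 \<le> L" and x0: "x0 \<in> S" "F x0 = 0"
  shows "measure_pmf.prob (kernel_power K t x0) {x. L \<le> F x} \<le> (real t + 1) * exp (\<theta> * (1 - L / 2))"
proof -
  define W where "W x = min (exp (\<theta> * F x)) (exp (\<theta> * L))" for x
  \<comment> \<open>From below \<open>L / 2\<close> one step raises \<open>F\<close> by at most 1,
    so \<open>C\<close> bounds \<open>W\<close> after such a step.\<close>
  define C where "C = exp (\<theta> * (L / 2 + 1))"
  have int: "integrable (measure_pmf p) f" if "set_pmf p \<subseteq> S" for p and f :: "'s \<Rightarrow> real"
    using that S by (intro integrable_measure_pmf_finite) (rule finite_subset)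
  have W_nonneg: "0 \<le> W x" for x by (simp add: W_def)
  have step: "measure_pmf.expectation (K x) W \<le> W x + C" if x: "x \<in> S" for x
  proof -
    note int = int[OF cl[OF x]]
    have const: "measure_pmf.expectation (K x) W \<le> c" if "\<And>y. y \<in> set_pmf (K x) \<Longrightarrow> W y \<le> c" for c
      by (rule measure_pmf.integral_le_const[OF int]) (use that in \<open>simp add: AE_measure_pmf_iff\<close>)
    \<comment> \<open>The step size settles the region below \<open>L / 2\<close>, the drift settles
      the band, and above \<open>L\<close> the truncated \<open>W\<close> is already
      maximal.\<close>
    consider "F x < L / 2" | "L / 2 \<le> F x" "F x \<le> L" | "L < F x" by linarith
    then show ?thesis
    proof cases
      case 1
      have "W y \<le> C" if "y \<in> set_pmf (K x)" for y
        using incr[OF x that] 1 \<open>0 < \<theta>\<close> unfolding W_def C_def by (intro min.coboundedI1) simp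
      then show ?thesis using const[of C] W_nonneg[of x] by simp
    next
      case 2
      have "measure_pmf.expectation (K x) W \<le> measure_pmf.expectation (K x) (\<lambda>y. exp (\<theta> * F y))"
        by (intro integral_mono int) (simp add: W_def)
      also note drift[OF x 2]
      also have "exp (\<theta> * F x) = W x" using 2 \<open>0 < \<theta>\<close> by (simp add: W_def)
      finally show ?thesis unfolding C_def by (rule add_increasing2[rotated]) simp
    next
      case 3
      have "measure_pmf.expectation (K x) W \<le> exp (\<theta> * L)"
        by (intro const) (simp add: W_def)
      also have "\<dots> = W x" using 3 \<open>0 < \<theta>\<close> by (simp add: W_def)
      finally show ?thesis unfolding C_def by (rule add_increasing2[rotated]) simp
    qed
  qed
  let ?p = "kernel_power K t x0"
  have supp: "set_pmf ?p \<subseteq> S" using cl x0(1) by (rule set_pmf_kernel_power_subset)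
  have "1 \<le> C" using \<open>0 < \<theta>\<close> \<open>0 \<le> L\<close> by (simp add: C_def)
  have "measure_pmf.prob ?p {x. L \<le> F x} = measure_pmf.expectation ?p (indicator {x. L \<le> F x})"
    by simp
  \<comment> \<open>Markov's inequality: \<open>W\<close> equals \<open>exp (\<theta> * L)\<close>
    on the event.\<close>
  also have "\<dots> \<le> measure_pmf.expectation ?p (\<lambda>x. exp (- \<theta> * L) * W x)"
  proof (intro integral_mono int supp)
    show "indicator {x. L \<le> F x} x \<le> exp (- \<theta> * L) * W x" for x
      using \<open>0 < \<theta>\<close> W_nonneg[of x] by (auto simp: indicator_def W_def min_def simp flip: exp_add)
  qed
  also have "\<dots> = exp (- \<theta> * L) * measure_pmf.expectation ?p W"
    by simp
  also have "\<dots> \<le> exp (- \<theta> * L) * (W x0 + real t * C)"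
    using S cl step x0(1) by (intro mult_left_mono expectation_kernel_power_le) auto
  \<comment> \<open>\<open>W x0 = 1\<close> is at most \<open>C\<close>, so the initial value counts
    as one more step.\<close>
  also have "\<dots> \<le> exp (- \<theta> * L) * ((real t + 1) * C)"
    using \<open>1 \<le> C\<close> x0(2) by (intro mult_left_mono) (auto simp: W_def algebra_simps)
  also have "\<dots> = (real t + 1) * exp (\<theta> * (1 - L / 2))"
  proof -
    have "exp (- \<theta> * L) * C = exp (\<theta> * (1 - L / 2))"
      by (simp add: C_def algebra_simps flip: exp_add)
    then show ?thesis by (metis mult.left_commute)
  qed
  finally show ?thesis .
qed

section \<open>Auxiliary estimates for exponentials and multisets\<close>

lemma exp_le_quadratic:
  fixes y :: real
  assumes "\<bar>y\<bar> \<le> 1"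
  shows "exp y \<le> 1 + y + y\<^sup>2"
proof (cases "0 \<le> y")
  case True
  then show ?thesis using assms by (intro exp_bound) auto
next
  case False
  \<comment> \<open>The second factor is a lower bound for \<open>exp (- y)\<close>. Expanding the
    product leaves 1 plus terms that are nonnegative for negative \<open>y\<close>.\<close>
  have "1 \<le> (1 + y + y\<^sup>2) * (1 - y + y\<^sup>2 / 2)"
  proof -
    have "(1 + y + y\<^sup>2) * (1 - y + y\<^sup>2 / 2) = 1 + y\<^sup>2 / 2 + (- y) * y\<^sup>2 / 2 + (y\<^sup>2)\<^sup>2 / 2"
      by (simp add: field_simps power2_eq_square)
    moreover have "0 \<le> (- y) * y\<^sup>2 / 2" using False by (intro divide_nonneg_pos mult_nonneg_nonneg) auto
    moreover have "0 \<le> (y\<^sup>2)\<^sup>2 / 2" "0 \<le> y\<^sup>2 / 2" by simp_all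
    ultimately show ?thesis by linarith
  qed
  also have "\<dots> \<le> (1 + y + y\<^sup>2) * exp (- y)"
    using exp_lower_Taylor_quadratic[of "- y"] False assms by (intro mult_left_mono) auto
  finally have "1 * exp y \<le> (1 + y + y\<^sup>2) * exp (- y) * exp y"
    by (intro mult_right_mono) auto
  then show ?thesis by (simp add: mult.assoc flip: exp_add)
qed

lemma sum_count_eq_sum_mset:
  fixes g :: "'a \<Rightarrow> real"
  assumes "finite A" "set_mset x \<subseteq> A"
  shows "(\<Sum>i\<in>A. real (count x i) * g i) = (\<Sum>i\<in>#x. g i)"
  using assms(2)
proof (induction x)
  case (add b x)
  have "real (count (add_mset b x) i) * g i = (if i = b then g b else 0) + real (count x i) * g i" for i
    by (simp add: algebra_simps)
  then have "(\<Sum>i\<in>A. real (count (add_mset b x) i) * g i)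
      = (\<Sum>i\<in>A. if i = b then g b else 0) + (\<Sum>i\<in>A. real (count x i) * g i)"
    by (simp only: sum.distrib)
  then show ?case using add \<open>finite A\<close> by simp
qed simp

lemma sum_mset_if_eq:
  fixes \<alpha> \<gamma> :: real
  shows "(\<Sum>i\<in>#x. if i = v then \<alpha> else \<gamma>) = real (count x v) * \<alpha> + (real (size x) - real (count x v)) * \<gamma>"
  by (induction x) (auto simp: algebra_simps)

section \<open>The kernel of attracting random walks\<close>

context pair_graph
begin

lemma finite_out: "finite {j. (i, j) \<in> parcs G}"
  by (rule finite_surj[OF pair_finite_arcs, of _ snd]) force

lemma card_insert_out_le:
  assumes "i \<in> pverts G"
  shows "card (insert i {j. (i, j) \<in> parcs G}) \<le> card (pverts G)"
  using assms arc_snd_in_verts by (intro card_mono pair_finite_verts) force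

lemma not_adj_self: "(i, i) \<notin> parcs G"
  using pair_no_loops by force

lemma arw_weight_nonneg: "0 \<le> arw_weight G \<beta> x i j"
  by (simp add: arw_weight_def)

lemma arw_weight_pos_iff: "0 < arw_weight G \<beta> x i j \<longleftrightarrow> j \<in> insert i {j. (i, j) \<in> parcs G}"
  by (simp add: arw_weight_def)

lemma arw_Z_eq_sum: "arw_Z G \<beta> x i = (\<Sum>j\<in>insert i {j. (i, j) \<in> parcs G}. arw_weight G \<beta> x i j)"
proof -
  have "(\<Sum>j\<in>{j. (i, j) \<in> parcs G}. arw_weight G \<beta> x i j)
      = (\<Sum>l\<in>{l. (i, l) \<in> parcs G}. exp (\<beta> / real (size x) * real (count x l)))"
    using not_adj_self by (intro sum.cong) (auto simp: arw_weight_def)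
  then show ?thesis
    using finite_out not_adj_self by (simp add: arw_Z_def arw_weight_def)
qed

lemma arw_Z_pos: "0 < arw_Z G \<beta> x i"
  unfolding arw_Z_def by (intro add_nonneg_pos sum_nonneg) auto

lemma set_pmf_arw_move: "set_pmf (arw_move G \<beta> x i) = insert i {j. (i, j) \<in> parcs G}"
proof -
  have "j \<in> set_pmf (arw_move G \<beta> x i) \<longleftrightarrow> 0 < arw_weight G \<beta> x i j" for j
    using arw_Z_pos[of \<beta> x i] arw_weight_nonneg[of \<beta> x i j]
    by (auto simp: set_pmf_iff pmf_arw_move[OF pair_graph_axioms])
  then show ?thesis by (auto simp: arw_weight_pos_iff)
qed

lemma set_pmf_arw_kernel:
  assumes "x \<noteq> {#}"
  shows "set_pmf (arw_kernel G \<beta> x) =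
    {x - {#i#} + {#j#} | i j. i \<in># x \<and> (j = i \<or> (i, j) \<in> parcs G)}"
  unfolding arw_kernel_def set_bind_pmf set_pmf_of_multiset[OF assms] set_pmf_arw_move set_return_pmf
  by blast

lemma set_pmf_arw_kernel_subset:
  assumes "0 < n" "x \<in> arw_configs G n"
  shows "set_pmf (arw_kernel G \<beta> x) \<subseteq> arw_configs G n"
proof
  fix y assume y: "y \<in> set_pmf (arw_kernel G \<beta> x)"
  have x: "set_mset x \<subseteq> pverts G" "size x = n"
    using assms by (auto simp: arw_configs_def multisets_of_size_def)
  then have "x \<noteq> {#}" using \<open>0 < n\<close> by auto
  then obtain i j where ij: "y = x - {#i#} + {#j#}" "i \<in># x" "j = i \<or> (i, j) \<in> parcs G"
    using y by (auto simp: set_pmf_arw_kernel)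
  then have "j \<in> pverts G" using x arc_snd_in_verts[of "(i, j)"] by auto
  moreover have "size y = n" using ij x \<open>0 < n\<close> by (simp add: size_Diff_singleton)
  ultimately show "y \<in> arw_configs G n"
    using ij x by (auto simp: arw_configs_def multisets_of_size_def dest: in_diffD)
qed

lemma arw_kernel_lazy:
  assumes "x \<noteq> {#}"
  shows "x \<in> set_pmf (arw_kernel G \<beta> x)"
proof -
  obtain i where "i \<in># x" using assms by auto
  then have "x = x - {#i#} + {#i#}" by simp
  then show ?thesis using \<open>i \<in># x\<close> unfolding set_pmf_arw_kernel[OF assms] by blast
qed

text \<open>Averaging over particles instead of vertices lets the drift be estimated one particle at
  a time; \<open>insert i\<close> covers the option of staying.\<close>

lemma expectation_arw_kernel:
  fixes f :: "'a multiset \<Rightarrow> real"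
  assumes "x \<noteq> {#}"
  shows "measure_pmf.expectation (arw_kernel G \<beta> x) f =
    (\<Sum>i\<in>#x. \<Sum>j\<in>insert i {j. (i, j) \<in> parcs G}.
       arw_weight G \<beta> x i j / arw_Z G \<beta> x i * f (x - {#i#} + {#j#})) / size x"
proof -
  have inner: "measure_pmf.expectation (arw_move G \<beta> x i \<bind> (\<lambda>j. return_pmf (x - {#i#} + {#j#}))) f =
     (\<Sum>j\<in>insert i {j. (i, j) \<in> parcs G}.
       arw_weight G \<beta> x i j / arw_Z G \<beta> x i * f (x - {#i#} + {#j#}))" for i
    using finite_out by (subst pmf_expectation_bind[of "insert i {j. (i, j) \<in> parcs G}"])
      (auto simp: set_pmf_arw_move pmf_arw_move[OF pair_graph_axioms] simp del: sum.insert)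
  have "measure_pmf.expectation (arw_kernel G \<beta> x) f =
     (\<Sum>i\<in>set_mset x. pmf (pmf_of_multiset x) i *\<^sub>R
       measure_pmf.expectation (arw_move G \<beta> x i \<bind> (\<lambda>j. return_pmf (x - {#i#} + {#j#}))) f)"
    unfolding arw_kernel_def using assms finite_out
    by (intro pmf_expectation_bind) (auto simp: set_pmf_arw_move)
  also have "\<dots> = (\<Sum>i\<in>set_mset x. real (count x i) * (\<Sum>j\<in>insert i {j. (i, j) \<in> parcs G}.
       arw_weight G \<beta> x i j / arw_Z G \<beta> x i * f (x - {#i#} + {#j#}))) / size x"
    unfolding inner sum_divide_distrib using assms by (intro sum.cong) (simp_all del: sum.insert)
  also have "\<dots> = (\<Sum>i\<in>#x. \<Sum>j\<in>insert i {j. (i, j) \<in> parcs G}.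
       arw_weight G \<beta> x i j / arw_Z G \<beta> x i * f (x - {#i#} + {#j#})) / size x"
    by (subst sum_count_eq_sum_mset) auto
  finally show ?thesis .
qed

section \<open>Irreducibility and existence of a mixing time\<close>

lemma arw_kernel_irreducible:
  assumes conn: "\<And>i j. i \<in> pverts G \<Longrightarrow> j \<in> pverts G \<Longrightarrow> (i, j) \<in> (parcs G)\<^sup>*"
    and "x \<in> arw_configs G n" "y \<in> arw_configs G n"
  shows "(x, y) \<in> {(x, y). y \<in> set_pmf (arw_kernel G \<beta> x)}\<^sup>*"
proof -
  let ?R = "{(x, y). y \<in> set_pmf (arw_kernel G \<beta> x)}"
  have single: "(add_mset i z, add_mset j z) \<in> ?R\<^sup>*" if "(i, j) \<in> (parcs G)\<^sup>*" for i j z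
    using that
  proof (induction rule: rtrancl_induct)
    case (step j k)
    have "add_mset k z \<in> set_pmf (arw_kernel G \<beta> (add_mset j z))"
      using \<open>(j, k) \<in> parcs G\<close>
      by (subst set_pmf_arw_kernel, simp) (intro CollectI exI[of _ j] exI[of _ k], simp)
    then have "(add_mset j z, add_mset k z) \<in> ?R" by simp
    with step.IH show ?case by (rule rtrancl_into_rtrancl)
  qed simp
  \<comment> \<open>Particles are relocated one after another. The spectators \<open>z\<close> are
    generalised because \<open>a\<close> waits among them while the rest of \<open>x\<close> moves;
    afterwards \<open>a\<close> walks to \<open>b\<close> while all others rest.\<close>
  have "size y = size x \<Longrightarrow> set_mset x \<subseteq> pverts G \<Longrightarrow> set_mset y \<subseteq> pverts G \<Longrightarrow>
      (x + z, y + z) \<in> ?R\<^sup>*" for x y z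
  proof (induction x arbitrary: y z)
    case (add a x)
    then obtain b y' where y: "y = add_mset b y'" by (cases y) auto
    have "(x + add_mset a z, y' + add_mset a z) \<in> ?R\<^sup>*"
      using add.prems y by (intro add.IH) auto
    moreover have "(add_mset a (y' + z), add_mset b (y' + z)) \<in> ?R\<^sup>*"
      using add.prems y by (intro single conn) auto
    ultimately show ?case by (auto simp: y)
  qed simp
  from this[of y x "{#}"] show ?thesis
    using assms(2,3) by (auto simp: arw_configs_def multisets_of_size_def)
qed

lemma ex_arw_mixing_dist_le:
  assumes conn: "\<And>i j. i \<in> pverts G \<Longrightarrow> j \<in> pverts G \<Longrightarrow> (i, j) \<in> (parcs G)\<^sup>*"
    and "pverts G \<noteq> {}" "0 < n" "0 < \<epsilon>"
  shows "\<exists>t. mixing_dist (arw_configs G n) (arw_kernel G \<beta>) t \<le> \<epsilon>"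
proof (rule ex_mixing_dist_le)
  show "finite (arw_configs G n)"
    using pair_finite_verts by (auto simp: arw_configs_def)
  obtain v where "v \<in> pverts G" using assms(2) by auto
  then have "replicate_mset n v \<in> arw_configs G n"
    by (auto simp: arw_configs_def multisets_of_size_def)
  then show "arw_configs G n \<noteq> {}" by blast
  show "x \<in> set_pmf (arw_kernel G \<beta> x)" if "x \<in> arw_configs G n" for x
    using that \<open>0 < n\<close> by (intro arw_kernel_lazy) (auto simp: arw_configs_def multisets_of_size_def)
qed (use assms set_pmf_arw_kernel_subset arw_kernel_irreducible in auto)

text \<open>The witness is the graph distance to \<open>v\<close>, the least length of a path; the
  first arc of a shortest path leads to a neighbour closer by one.\<close>

lemma ex_distance_function:
  assumes conn: "\<And>i. i \<in> pverts G \<Longrightarrow> (i, v) \<in> (parcs G)\<^sup>*"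
  obtains d :: "'a \<Rightarrow> nat" where "\<And>i. i \<in> pverts G \<Longrightarrow> d i = 0 \<longleftrightarrow> i = v"
    and "\<And>i j. (i, j) \<in> parcs G \<Longrightarrow> d i \<le> d j + 1"
    and "\<And>i. i \<in> pverts G \<Longrightarrow> i \<noteq> v \<Longrightarrow> \<exists>j. (i, j) \<in> parcs G \<and> d i = d j + 1"
proof
  define d where "d i = (LEAST l. (i, v) \<in> parcs G ^^ l)" for i
  have d: "(i, v) \<in> parcs G ^^ d i" if "i \<in> pverts G" for i
    unfolding d_def using conn[OF that] by (auto simp: rtrancl_power intro: LeastI)
  have d_le: "d i \<le> l" if "(i, v) \<in> parcs G ^^ l" for i l
    unfolding d_def using that by (rule Least_le)
  show d_0: "d i = 0 \<longleftrightarrow> i = v" if "i \<in> pverts G" for i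
    using d[OF that] d_le[of i 0] by auto
  show adj: "d i \<le> d j + 1" if that: "(i, j) \<in> parcs G" for i j
  proof -
    have "j \<in> pverts G" using arc_snd_in_verts[OF that] by simp
    then have "(i, v) \<in> parcs G ^^ Suc (d j)" using that d by (blast intro: relpow_Suc_I2)
    then show ?thesis using d_le by fastforce
  qed
  show "\<exists>j. (i, j) \<in> parcs G \<and> d i = d j + 1" if i: "i \<in> pverts G" "i \<noteq> v" for i
  proof -
    obtain l where l: "d i = Suc l" using d_0[OF i(1)] i(2) by (cases "d i") auto
    then obtain j where j: "(i, j) \<in> parcs G" "(j, v) \<in> parcs G ^^ l"
      using d[OF i(1)] by (metis relpow_Suc_D2)
    then have "d i = d j + 1" using adj[OF j(1)] d_le[OF j(2)] l by simp
    with j show ?thesis by blast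
  qed
qed

subsection \<open>Drift\<close>

text \<open>This is the generator of the move of one selected particle with the configuration
  \<open>x\<close> frozen. Averaged over the particles, it is the drift of the sum of
  \<open>h\<close>.\<close>

definition arw_drift :: "real \<Rightarrow> 'a multiset \<Rightarrow> ('a \<Rightarrow> real) \<Rightarrow> 'a \<Rightarrow> real" where
  "arw_drift \<beta> x h i =
     (\<Sum>j\<in>insert i {j. (i, j) \<in> parcs G}. arw_weight G \<beta> x i j / arw_Z G \<beta> x i * (h j - h i))"

lemma sum_arw_move: "(\<Sum>j\<in>insert i {j. (i, j) \<in> parcs G}. arw_weight G \<beta> x i j / arw_Z G \<beta> x i) = 1"
  using arw_Z_pos[of \<beta> x i] by (simp only: sum_divide_distrib[symmetric] arw_Z_eq_sum[symmetric]) simp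

lemma arw_weight_le_exp:
  assumes "0 \<le> \<beta>"
  shows "arw_weight G \<beta> x i j \<le> exp (\<beta> * real (count x j) / real (size x))"
proof -
  have "\<beta> / real (size x) * (real (count x i) - 1) \<le> \<beta> * real (count x i) / real (size x)"
    using assms by (simp add: field_simps divide_right_mono)
  then show ?thesis by (simp add: arw_weight_def)
qed

text \<open>Staying at \<open>v\<close> has weight at least \<open>exp (\<beta> - 2)\<close>, while
  a neighbour holds at most a fraction 1/\<beta> of the particles and has weight at most
  \<open>exp 1\<close>. Thus each neighbour is chosen with probability at most
  \<open>exp (3 - \<beta>)\<close>.\<close>

lemma arw_drift_centre_le:
  fixes \<beta> :: real
  assumes \<beta>: "0 < \<beta>" "\<beta> \<le> size x" and x: "x \<noteq> {#}" "size x - size x / \<beta> \<le> count x v"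
    and v: "v \<in> pverts G" and h: "\<And>j. h j \<le> 1" "h v = 0"
  shows "arw_drift \<beta> x h v \<le> card (pverts G) * exp (3 - \<beta>)"
proof -
  let ?N = "{j. (v, j) \<in> parcs G}"
  let ?n = "real (size x)"
  have n: "0 < ?n" using x(1) by (simp add: nonempty_has_size)
  have Z: "exp (\<beta> - 2) \<le> arw_Z G \<beta> x v"
  proof -
    \<comment> \<open>The exponent loses 1 through the particles away from \<open>v\<close>, and at
      most 1 because the selected particle does not count itself; the latter needs \<beta> to be at
      most the number of particles.\<close>
    have "\<beta> / ?n * (?n - ?n / \<beta> - 1) \<le> \<beta> / ?n * (real (count x v) - 1)"
      using \<beta> x n by (intro mult_left_mono) auto
    moreover have "\<beta> / ?n * (?n - ?n / \<beta> - 1) = \<beta> - 1 - \<beta> / ?n"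
      using x(1) \<beta>(1) by (simp add: right_diff_distrib)
    moreover have "\<beta> / ?n \<le> 1" using \<beta> n by simp
    ultimately have "\<beta> - 2 \<le> \<beta> / ?n * (real (count x v) - 1)" by linarith
    then have "exp (\<beta> - 2) \<le> arw_weight G \<beta> x v v"
      by (simp add: arw_weight_def)
    also have "\<dots> \<le> arw_Z G \<beta> x v"
      unfolding arw_Z_eq_sum using finite_out by (intro member_le_sum) (auto simp: arw_weight_nonneg)
    finally show ?thesis .
  qed
  have "arw_drift \<beta> x h v = (\<Sum>j\<in>?N. arw_weight G \<beta> x v j / arw_Z G \<beta> x v * h j)"
    unfolding arw_drift_def using finite_out[of v] not_adj_self[of v] h(2) by simp
  also have "\<dots> \<le> (\<Sum>j\<in>?N. exp (3 - \<beta>))"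
  proof (rule sum_mono)
    fix j assume "j \<in> ?N"
    then have "j \<noteq> v" using not_adj_self by auto
    have "real (count x j) + real (count x v) \<le> ?n"
      using \<open>j \<noteq> v\<close> by (induction x) auto
    then have "real (count x j) \<le> ?n / \<beta>" using x(2) by linarith
    then have "\<beta> * real (count x j) / ?n \<le> 1" using \<beta> n by (simp add: field_simps)
    then have w: "arw_weight G \<beta> x v j \<le> exp 1"
      using arw_weight_le_exp[of \<beta> x v j] \<beta> by (meson exp_le_cancel_iff less_imp_le order_trans)
    have "arw_weight G \<beta> x v j / arw_Z G \<beta> x v * h j \<le> arw_weight G \<beta> x v j / arw_Z G \<beta> x v * 1"
      using arw_Z_pos[of \<beta> x v] arw_weight_nonneg h(1) by (intro mult_left_mono) auto
    also have "\<dots> \<le> exp 1 / exp (\<beta> - 2)"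
      using w Z arw_weight_nonneg by (simp add: frac_le)
    also have "\<dots> = exp (3 - \<beta>)" by (simp flip: exp_diff)
    finally show "arw_weight G \<beta> x v j / arw_Z G \<beta> x v * h j \<le> exp (3 - \<beta>)" .
  qed
  also have "\<dots> = card ?N * exp (3 - \<beta>)" by simp
  also have "\<dots> \<le> card (pverts G) * exp (3 - \<beta>)"
    using card_insert_out_le[OF v] finite_out[of v] not_adj_self[of v] by (intro mult_right_mono) auto
  finally show ?thesis .
qed

text \<open>A neighbour \<open>js\<close> one step closer to \<open>v\<close> is chosen with
  probability at least 1/(3k) = 2a, where k is the number of vertices. In the geometric profile,
  approaching gains a^(d-1) - a^d while moving away costs at most a^d - a^(d+1), so this probability
  outweighs all other moves.\<close>

lemma arw_drift_outside_le:
  fixes d :: "'a \<Rightarrow> nat"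
  assumes d_0: "\<And>i. i \<in> pverts G \<Longrightarrow> d i = 0 \<longleftrightarrow> i = v"
    and d_adj: "\<And>i j. (i, j) \<in> parcs G \<Longrightarrow> d i \<le> d j + 1"
    and d_ex: "\<And>i. i \<in> pverts G \<Longrightarrow> i \<noteq> v \<Longrightarrow> \<exists>j. (i, j) \<in> parcs G \<and> d i = d j + 1"
    and d_le: "d i \<le> D"
    and a: "a = 1 / (6 * real (card (pverts G)))"
    and \<beta>: "2 \<le> \<beta>" and x: "x \<noteq> {#}" "size x - size x / \<beta> \<le> count x v"
    and i: "i \<in> pverts G" "i \<noteq> v"
  shows "arw_drift \<beta> x (\<lambda>i. 1 - a ^ d i) i \<le> - (a ^ D / 2)"
proof -
  let ?T = "insert i {j. (i, j) \<in> parcs G}"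
  let ?k = "real (card (pverts G))"
  let ?n = "real (size x)"
  let ?w = "arw_weight G \<beta> x i"
  let ?Z = "arw_Z G \<beta> x i"
  have n: "0 < ?n" using x(1) by (simp add: nonempty_has_size)
  have k: "1 \<le> ?k" using i(1) pair_finite_verts by (auto simp: Suc_le_eq card_gt_0_iff)
  have a_bounds: "0 < a" "a \<le> 1 / 2" using k by (auto simp: a field_simps)
  obtain js where js: "(i, js) \<in> parcs G" "d i = d js + 1" using d_ex[OF i] by auto
  have js_T: "js \<in> ?T" and "js \<noteq> i" using js not_adj_self by auto
  have js_V: "js \<in> pverts G" using arc_snd_in_verts[OF js(1)] by simp
  have w_js: "?w js = exp (\<beta> * real (count x js) / ?n)"
    using js \<open>js \<noteq> i\<close> by (simp add: arw_weight_def)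
  have other: "real (count x j) \<le> ?n / \<beta>" if "j \<noteq> v" for j
  proof -
    have "real (count x j) + real (count x v) \<le> ?n"
      using that by (induction x) auto
    then show ?thesis using x(2) by linarith
  qed
  \<comment> \<open>If \<open>js\<close> is \<open>v\<close>, it holds at least half of the
    particles and no option is heavier. Otherwise \<open>v\<close> is out of reach in one step, so
    every option holds at most a fraction 1/\<beta> and weighs at most \<open>exp 1\<close>, while
    \<open>js\<close> weighs at least 1.\<close>
  have w_le: "?w j \<le> 3 * ?w js" if j: "j \<in> ?T" for j
  proof (cases "js = v")
    case True
    have "?n / \<beta> \<le> ?n / 2" using \<beta> n by (intro divide_left_mono) auto
    then have "real (count x j) \<le> real (count x v)"
      using other[of j] x(2) by (cases "j = v") (simp, linarith)
    then have "\<beta> * real (count x j) / ?n \<le> \<beta> * real (count x js) / ?n"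
      using \<beta> True by (intro divide_right_mono mult_left_mono) auto
    then have "?w j \<le> ?w js"
      using arw_weight_le_exp[of \<beta> x i j] \<beta> unfolding w_js
      by (meson exp_le_cancel_iff order_trans zero_le_numeral)
    also have "\<dots> \<le> 3 * ?w js" using arw_weight_nonneg[of \<beta> x i js] by simp
    finally show ?thesis .
  next
    case False
    have "j \<noteq> v"
    proof
      assume "j = v"
      with j i have "(i, v) \<in> parcs G" by auto
      then have "d i \<le> d v + 1" "v \<in> pverts G" using d_adj arc_snd_in_verts by force+
      then have "d js = 0" using js(2) d_0[of v] by auto
      then show False using d_0[OF js_V] False by simp
    qed
    then have "\<beta> * real (count x j) / ?n \<le> 1" using other[of j] \<beta> n by (simp add: field_simps)
    then have "?w j \<le> exp 1"
      using arw_weight_le_exp[of \<beta> x i j] \<beta> by (meson exp_le_cancel_iff order_trans zero_le_numeral)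
    also have "\<dots> \<le> 3 * 1" using exp_le by simp
    also have "\<dots> \<le> 3 * ?w js" unfolding w_js using \<beta> by (intro mult_left_mono) auto
    finally show ?thesis .
  qed
  have "?Z \<le> (\<Sum>j\<in>?T. 3 * ?w js)"
    unfolding arw_Z_eq_sum using w_le by (intro sum_mono)
  also have "\<dots> = card ?T * (3 * ?w js)" by simp
  also have "\<dots> \<le> ?k * (3 * ?w js)"
    using card_insert_out_le[OF i(1)] arw_weight_nonneg by (intro mult_right_mono) auto
  finally have p: "2 * a \<le> ?w js / ?Z"
    using arw_Z_pos[of \<beta> x i] k by (simp add: a field_simps)
  let ?s = "d js"
  have "arw_drift \<beta> x (\<lambda>i. 1 - a ^ d i) i = (\<Sum>j\<in>?T. ?w j / ?Z * (a ^ d i - a ^ d j))"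
    by (simp add: arw_drift_def)
  \<comment> \<open>The term for \<open>js\<close> keeps the nonnegative cost of moving away as
    slack, so that this cost is multiplied by the total probability 1.\<close>
  also have "\<dots> \<le> (\<Sum>j\<in>?T. ?w j / ?Z * (a ^ d i - a ^ (d i + 1)) +
      (if j = js then - (?w js / ?Z * (a ^ ?s - a ^ d i)) else 0))"
  proof (rule sum_mono)
    fix j assume j: "j \<in> ?T"
    have nonneg: "0 \<le> ?w j / ?Z" using arw_weight_nonneg arw_Z_pos[of \<beta> x i] by simp
    show "?w j / ?Z * (a ^ d i - a ^ d j) \<le> ?w j / ?Z * (a ^ d i - a ^ (d i + 1)) +
      (if j = js then - (?w js / ?Z * (a ^ ?s - a ^ d i)) else 0)"
    proof (cases "j = js")
      case True
      have "a ^ (d i + 1) \<le> a ^ d i" using a_bounds by (intro power_decreasing) auto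
      then have "0 \<le> ?w j / ?Z * (a ^ d i - a ^ (d i + 1))"
        using nonneg by (intro mult_nonneg_nonneg) auto
      moreover have "?w j / ?Z * (a ^ d i - a ^ d j) = - (?w js / ?Z * (a ^ ?s - a ^ d i))"
        by (simp add: True right_diff_distrib)
      ultimately show ?thesis using True by simp
    next
      case False
      \<comment> \<open>Symmetry of the arcs bounds the distance from above.\<close>
      have "d j \<le> d i + 1"
      proof (cases "j = i")
        case False
        then have "(j, i) \<in> parcs G" using j pair_sym_arcs by (auto simp: symmetric_def dest: symD)
        then show ?thesis by (rule d_adj)
      qed simp
      then have "a ^ (d i + 1) \<le> a ^ d j" using a_bounds by (intro power_decreasing) auto
      then have "?w j / ?Z * (a ^ d i - a ^ d j) \<le> ?w j / ?Z * (a ^ d i - a ^ (d i + 1))"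
        using nonneg by (intro mult_left_mono) auto
      then show ?thesis using False by simp
    qed
  qed
  also have "\<dots> = (\<Sum>j\<in>?T. ?w j / ?Z) * (a ^ d i - a ^ (d i + 1)) - ?w js / ?Z * (a ^ ?s - a ^ d i)"
    unfolding sum.distrib sum_distrib_right using finite_out js_T by (simp del: sum.insert add: sum.delta)
  also have "\<dots> = (a ^ d i - a ^ (d i + 1)) - ?w js / ?Z * (a ^ ?s - a ^ d i)"
    by (simp only: sum_arw_move mult_1)
  also have "\<dots> \<le> (a ^ d i - a ^ (d i + 1)) - 2 * a * (a ^ ?s - a ^ d i)"
  proof -
    have "a ^ d i \<le> a ^ ?s" using a_bounds js(2) by (intro power_decreasing) auto
    then have "2 * a * (a ^ ?s - a ^ d i) \<le> ?w js / ?Z * (a ^ ?s - a ^ d i)"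
      using p by (intro mult_right_mono) auto
    then show ?thesis by simp
  qed
  \<comment> \<open>\<open>a * a ^ d js = a ^ d i\<close> collapses the two differences.\<close>
  also have "\<dots> = - ((1 - a) * a ^ d i)"
    by (simp add: js(2) algebra_simps)
  also have "\<dots> \<le> - (1 / 2 * a ^ D)"
    using a_bounds d_le by (intro le_imp_neg_le mult_mono power_decreasing) auto
  finally show ?thesis by simp
qed

text \<open>As \<open>h\<close> changes by at most 1 in a move, \<open>exp_le_quadratic\<close>
  leaves a second-order term of at most \<open>\<eta>\<^sup>2\<close> per particle. The assumed
  drift, multiplied by \<eta>, cancels the total of these terms.\<close>

lemma expectation_exp_drift_le:
  fixes h :: "'a \<Rightarrow> real" and \<eta> :: real
  assumes "x \<noteq> {#}" and \<eta>: "0 \<le> \<eta>" "\<eta> \<le> 1" and h: "\<And>i. 0 \<le> h i" "\<And>i. h i \<le> 1"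
    and drift: "(\<Sum>i\<in>#x. arw_drift \<beta> x h i) \<le> - (\<eta> * size x)"
  shows "measure_pmf.expectation (arw_kernel G \<beta> x) (\<lambda>y. exp (\<eta> * (\<Sum>i\<in>#y. h i)))
           \<le> exp (\<eta> * (\<Sum>i\<in>#x. h i))"
proof -
  let ?T = "\<lambda>i. insert i {j. (i, j) \<in> parcs G}"
  let ?p = "\<lambda>i j. arw_weight G \<beta> x i j / arw_Z G \<beta> x i"
  let ?F = "\<lambda>y. \<Sum>i\<in>#y. h i"
  have n: "0 < real (size x)" using assms(1) by (simp add: nonempty_has_size)
  have p: "0 \<le> ?p i j" for i j using arw_weight_nonneg arw_Z_pos[of \<beta> x i] by simp
  have F: "?F (x - {#i#} + {#j#}) = ?F x + (h j - h i)" if i: "i \<in># x" for i j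
  proof -
    obtain z where "x = add_mset i z" using i by (meson multi_member_split)
    then show ?thesis by simp
  qed
  have inner: "(\<Sum>j\<in>?T i. ?p i j * exp (\<eta> * ?F (x - {#i#} + {#j#})))
      \<le> exp (\<eta> * ?F x) * (1 + \<eta>\<^sup>2 + \<eta> * arw_drift \<beta> x h i)" if i: "i \<in># x" for i
  proof -
    have "(\<Sum>j\<in>?T i. ?p i j * exp (\<eta> * ?F (x - {#i#} + {#j#})))
        \<le> (\<Sum>j\<in>?T i. ?p i j * (exp (\<eta> * ?F x) * (1 + \<eta>\<^sup>2 + \<eta> * (h j - h i))))"
    proof (intro sum_mono mult_left_mono p)
      fix j
      have b: "\<bar>h j - h i\<bar> \<le> 1" using h(1)[of i] h(1)[of j] h(2)[of i] h(2)[of j] by linarith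
      then have "\<bar>\<eta> * (h j - h i)\<bar> \<le> \<eta> * 1"
        using \<eta> unfolding abs_mult by (intro mult_mono) auto
      then have c: "\<bar>\<eta> * (h j - h i)\<bar> \<le> \<eta>" by simp
      then have "(\<eta> * (h j - h i))\<^sup>2 \<le> \<eta>\<^sup>2"
        using \<eta> by (metis abs_le_square_iff abs_of_nonneg)
      then have "exp (\<eta> * (h j - h i)) \<le> 1 + \<eta>\<^sup>2 + \<eta> * (h j - h i)"
        using exp_le_quadratic[of "\<eta> * (h j - h i)"] c \<eta> by linarith
      then show "exp (\<eta> * ?F (x - {#i#} + {#j#})) \<le> exp (\<eta> * ?F x) * (1 + \<eta>\<^sup>2 + \<eta> * (h j - h i))"
        unfolding F[OF i] distrib_left[of \<eta> "?F x" "h j - h i"] exp_add by (intro mult_left_mono) simp_all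
    qed
    also have "\<dots> = (\<Sum>j\<in>?T i. exp (\<eta> * ?F x) * (1 + \<eta>\<^sup>2) * ?p i j + exp (\<eta> * ?F x) * \<eta> * (?p i j * (h j - h i)))"
      by (intro sum.cong refl) (simp add: algebra_simps diff_divide_distrib)
    also have "\<dots> = exp (\<eta> * ?F x) * (1 + \<eta>\<^sup>2) * (\<Sum>j\<in>?T i. ?p i j) + exp (\<eta> * ?F x) * \<eta> * arw_drift \<beta> x h i"
      unfolding arw_drift_def sum.distrib sum_distrib_left ..
    also have "\<dots> = exp (\<eta> * ?F x) * (1 + \<eta>\<^sup>2 + \<eta> * arw_drift \<beta> x h i)"
      unfolding sum_arw_move by (simp add: algebra_simps)
    finally show ?thesis .
  qed
  have "(\<Sum>i\<in>#x. \<Sum>j\<in>?T i. ?p i j * exp (\<eta> * ?F (x - {#i#} + {#j#})))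
      \<le> (\<Sum>i\<in>#x. exp (\<eta> * ?F x) * (1 + \<eta>\<^sup>2 + \<eta> * arw_drift \<beta> x h i))"
    using inner by (rule sum_mset_mono)
  also have "\<dots> = exp (\<eta> * ?F x) * (real (size x) * (1 + \<eta>\<^sup>2) + \<eta> * (\<Sum>i\<in>#x. arw_drift \<beta> x h i))"
    by (simp add: sum_mset.distrib flip: sum_mset_distrib_left)
  also have "\<dots> \<le> exp (\<eta> * ?F x) * (real (size x) * (1 + \<eta>\<^sup>2) + \<eta> * (- (\<eta> * size x)))"
    using drift \<eta> by (intro mult_left_mono add_left_mono) auto
  also have "\<dots> = exp (\<eta> * ?F x) * size x"
    by (simp add: algebra_simps power2_eq_square)
  finally show ?thesis
    unfolding expectation_arw_kernel[OF assms(1)] using n by (simp only: pos_divide_le_eq)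
qed

subsection \<open>Metastability\<close>

text \<open>The threshold \<open>b\<close> depends only on the graph and \<open>v\<close>, the rate
  \<open>c\<close> also on \<beta>. The threshold exists because the outflow from \<open>v\<close>
  is exponentially small in \<beta>, while the inward pull decays only like 1/\<beta>.\<close>

lemma arw_metastable:
  assumes v: "v \<in> pverts G" and conn: "\<And>i. i \<in> pverts G \<Longrightarrow> (i, v) \<in> (parcs G)\<^sup>*"
  shows "\<exists>b. \<forall>\<beta>\<ge>b. \<exists>c>0. \<forall>\<^sub>F n in sequentially. \<forall>t.
    measure_pmf.prob (kernel_power (arw_kernel G \<beta>) t (replicate_mset n v)) {x. 2 * count x v \<le> size x}
      \<le> (real t + 1) * exp (1 - c * real n)"
proof (rule ex_distance_function)
  fix d :: "'a \<Rightarrow> nat"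
  assume d_0: "\<And>i. i \<in> pverts G \<Longrightarrow> d i = 0 \<longleftrightarrow> i = v"
    and d_adj: "\<And>i j. (i, j) \<in> parcs G \<Longrightarrow> d i \<le> d j + 1"
    and d_ex: "\<And>i. i \<in> pverts G \<Longrightarrow> i \<noteq> v \<Longrightarrow> \<exists>j. (i, j) \<in> parcs G \<and> d i = d j + 1"
  define D where "D = Max (d ` pverts G)"
  have d_le: "d i \<le> D" if "i \<in> pverts G" for i
    unfolding D_def using that pair_finite_verts by auto
  let ?k = "real (card (pverts G))"
  have k: "1 \<le> ?k" using v pair_finite_verts by (auto simp: Suc_le_eq card_gt_0_iff)
  define a where "a = 1 / (6 * ?k)"
  have a: "0 < a" "a \<le> 1 / 2" using k by (auto simp: a_def field_simps)
  define h where "h i = 1 - a ^ d i" for i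
  have h_bounds: "0 \<le> h i" "h i \<le> 1" for i
    using a by (auto simp: h_def power_le_one)
  have h_v: "h v = 0" using d_0[OF v] by (simp add: h_def)
  have h_ge: "1 / 2 \<le> h i" if "i \<in> pverts G" "i \<noteq> v" for i
  proof -
    have "1 \<le> d i" using d_0[OF that(1)] that(2) by simp
    then have "a ^ d i \<le> a ^ 1" using a by (intro power_decreasing) auto
    then show ?thesis using a by (simp add: h_def)
  qed
  define F where "F x = (\<Sum>i\<in>#x. h i)" for x
  have F_bounds: "(real (size x) - real (count x v)) / 2 \<le> F x" "F x \<le> real (size x) - real (count x v)"
    if "set_mset x \<subseteq> pverts G" for x
  proof -
    have "(\<Sum>i\<in>#x. if i = v then 0 else 1 / 2) \<le> F x"
      unfolding F_def using h_ge h_v that by (intro sum_mset_mono) auto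
    then show "(real (size x) - real (count x v)) / 2 \<le> F x" by (simp add: sum_mset_if_eq)
    have "F x \<le> (\<Sum>i\<in>#x. if i = v then 0 else 1)"
      unfolding F_def using h_bounds h_v by (intro sum_mset_mono) auto
    then show "F x \<le> real (size x) - real (count x v)" by (simp add: sum_mset_if_eq)
  qed
  have aD: "0 < a ^ D" "a ^ D \<le> 1" using a by (auto simp: power_le_one)
  have "\<forall>\<^sub>F \<beta> in at_top. ?k * exp (3 - \<beta>) \<le> a ^ D / (16 * \<beta>)"
    using aD(1) k by real_asymp
  then have "\<forall>\<^sub>F \<beta> in at_top. 2 \<le> \<beta> \<and> ?k * exp (3 - \<beta>) \<le> a ^ D / (16 * \<beta>)"
    using eventually_ge_at_top[of 2] by eventually_elim auto
  then obtain b where b: "\<And>\<beta>. b \<le> \<beta> \<Longrightarrow> 2 \<le> \<beta> \<and> ?k * exp (3 - \<beta>) \<le> a ^ D / (16 * \<beta>)"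
    by (auto simp: eventually_at_top_linorder)
  show ?thesis
  proof (rule exI[of _ b], intro allI impI)
    fix \<beta> assume "b \<le> \<beta>"
    then have \<beta>: "2 \<le> \<beta>" "?k * exp (3 - \<beta>) \<le> a ^ D / (16 * \<beta>)" using b by auto
    \<comment> \<open>\<eta> bounds the outward drift of a particle at \<open>v\<close> and is also
      the exponent parameter. The 16 makes the pull of n/(4\<beta>) particles, each at least
      \<open>a ^ D / 2\<close>, equal to \<open>2 * (\<eta> * real n)\<close>: half cancels the
      outflow, half the second-order terms.\<close>
    define \<eta> where "\<eta> = a ^ D / (16 * \<beta>)"
    have \<eta>: "0 < \<eta>" "\<eta> \<le> 1" using aD \<beta>(1) by (auto simp: \<eta>_def field_simps)
    show "\<exists>c>0. \<forall>\<^sub>F n in sequentially. \<forall>t.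
      measure_pmf.prob (kernel_power (arw_kernel G \<beta>) t (replicate_mset n v)) {x. 2 * count x v \<le> size x}
        \<le> (real t + 1) * exp (1 - c * real n)"
    proof (intro exI[of _ "\<eta> / (4 * \<beta>)"] conjI)
      show "0 < \<eta> / (4 * \<beta>)" using \<eta> \<beta> by simp
      have "\<forall>\<^sub>F n in sequentially. \<beta> \<le> real n"
        by real_asymp
      then show "\<forall>\<^sub>F n in sequentially. \<forall>t.
        measure_pmf.prob (kernel_power (arw_kernel G \<beta>) t (replicate_mset n v)) {x. 2 * count x v \<le> size x}
          \<le> (real t + 1) * exp (1 - \<eta> / (4 * \<beta>) * real n)"
      proof eventually_elim
        case (elim n)
        have n: "0 < n" using elim \<beta>(1) by (cases n) auto
        let ?S = "arw_configs G n"
        let ?K = "arw_kernel G \<beta>"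
        let ?x0 = "replicate_mset n v"
        \<comment> \<open>Every particle away from \<open>v\<close> contributes between 1/2 and 1 to
          \<open>F\<close>. So \<open>F x \<le> L\<close> leaves at most n/\<beta> of them, as the
          drift bounds require, and \<open>L / 2 \<le> F x\<close> forces at least
          n/(4\<beta>).\<close>
        define L where "L = real n / (2 * \<beta>)"
        have L: "0 \<le> L" using \<beta> by (simp add: L_def)
        have S: "finite ?S" using pair_finite_verts by (auto simp: arw_configs_def)
        have cl: "set_pmf (?K x) \<subseteq> ?S" if "x \<in> ?S" for x
          using n that by (rule set_pmf_arw_kernel_subset)
        have conf: "set_mset x \<subseteq> pverts G" "size x = n" "x \<noteq> {#}" if "x \<in> ?S" for x
          using that n by (auto simp: arw_configs_def multisets_of_size_def)
        have x0: "?x0 \<in> ?S" using v by (auto simp: arw_configs_def multisets_of_size_def)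
        have incr: "F y \<le> F x + 1" if x: "x \<in> ?S" and y: "y \<in> set_pmf (?K x)" for x y
        proof -
          obtain i j where ij: "y = x - {#i#} + {#j#}" "i \<in># x"
            using y set_pmf_arw_kernel[OF conf(3)[OF x]] by blast
          then obtain z where "x = add_mset i z" by (meson multi_member_split)
          then show ?thesis using ij(1) h_bounds(1)[of i] h_bounds(2)[of j] by (simp add: F_def)
        qed
        have drift: "measure_pmf.expectation (?K x) (\<lambda>y. exp (\<eta> * F y)) \<le> exp (\<eta> * F x)"
          if x: "x \<in> ?S" and lo: "L / 2 \<le> F x" and hi: "F x \<le> L" for x
          unfolding F_def
        proof (rule expectation_exp_drift_le)
          note x' = conf[OF x]
          have m: "real (size x) - real (size x) / \<beta> \<le> real (count x v)"
            using F_bounds(1)[OF x'(1)] hi by (simp add: L_def x'(2))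
          have "(\<Sum>i\<in>#x. arw_drift \<beta> x h i) \<le> (\<Sum>i\<in>#x. if i = v then \<eta> else - (a ^ D / 2))"
          proof (rule sum_mset_mono)
            fix i assume "i \<in># x"
            then have i: "i \<in> pverts G" using x' by auto
            show "arw_drift \<beta> x h i \<le> (if i = v then \<eta> else - (a ^ D / 2))"
            proof (cases "i = v")
              case True
              have "arw_drift \<beta> x h v \<le> ?k * exp (3 - \<beta>)"
                using \<beta> elim m x' v h_bounds(2) h_v by (intro arw_drift_centre_le) auto
              then show ?thesis using True \<beta>(2) by (simp add: \<eta>_def)
            next
              case False
              have "arw_drift \<beta> x h i \<le> - (a ^ D / 2)"
                unfolding h_def
                by (rule arw_drift_outside_le[OF d_0 d_adj d_ex d_le[OF i] a_def \<beta>(1) x'(3) m i False])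
              then show ?thesis using False by simp
            qed
          qed
          also have "\<dots> = real (count x v) * \<eta> - (real n - real (count x v)) * (a ^ D / 2)"
            by (simp add: sum_mset_if_eq x'(2))
          also have "\<dots> \<le> real n * \<eta> - real n / (4 * \<beta>) * (a ^ D / 2)"
          proof (rule diff_mono)
            show "real (count x v) * \<eta> \<le> real n * \<eta>"
              using \<eta> count_le_size[of x v] x'(2) by (intro mult_right_mono) auto
            have "real n / (4 * \<beta>) \<le> real n - real (count x v)"
              using F_bounds(2)[OF x'(1)] lo by (simp add: L_def x'(2))
            then show "real n / (4 * \<beta>) * (a ^ D / 2) \<le> (real n - real (count x v)) * (a ^ D / 2)"
              using aD by (intro mult_right_mono) auto
          qed
          also have "real n / (4 * \<beta>) * (a ^ D / 2) = 2 * (\<eta> * real n)"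
            using \<beta> by (simp add: \<eta>_def)
          finally show "(\<Sum>i\<in>#x. arw_drift \<beta> x h i) \<le> - (\<eta> * size x)"
            by (simp add: x'(2) algebra_simps)
        qed (use conf[OF x] \<eta> h_bounds in auto)
        have "F ?x0 = 0" by (simp add: F_def h_v)
        have bound: "measure_pmf.prob (kernel_power ?K t ?x0) {x. L \<le> F x}
            \<le> (real t + 1) * exp (\<eta> * (1 - L / 2))" for t
          by (rule prob_kernel_power_ge_le[OF S cl incr drift \<eta>(1) L x0 \<open>F ?x0 = 0\<close>])
        show ?case
        proof
          fix t
          let ?p = "kernel_power ?K t ?x0"
          have supp: "set_pmf ?p \<subseteq> ?S" using cl x0 by (rule set_pmf_kernel_power_subset)
          have "measure_pmf.prob ?p {x. 2 * count x v \<le> size x} \<le> measure_pmf.prob ?p {x. L \<le> F x}"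
          proof (rule measure_pmf.finite_measure_mono_AE)
            \<comment> \<open>With at most half of the particles at \<open>v\<close>,
              \<open>F\<close> is at least n/4, hence at least \<open>L\<close> as \<beta> is at
              least 2.\<close>
            have "L \<le> F x" if "x \<in> set_pmf ?p" "2 * count x v \<le> size x" for x
            proof -
              have x: "x \<in> ?S" using that supp by auto
              have "L \<le> real n / (2 * 2)"
                unfolding L_def using \<beta>(1) by (intro divide_left_mono) auto
              also have "\<dots> \<le> (real (size x) - real (count x v)) / 2"
                using that(2) conf(2)[OF x] by simp
              also have "\<dots> \<le> F x" by (rule F_bounds(1)[OF conf(1)[OF x]])
              finally show ?thesis .
            qed
            then show "AE x in measure_pmf ?p. x \<in> {x. 2 * count x v \<le> size x} \<longrightarrow> x \<in> {x. L \<le> F x}"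
              by (simp add: AE_measure_pmf_iff)
          qed simp
          also note bound[of t]
          also have "(real t + 1) * exp (\<eta> * (1 - L / 2)) \<le> (real t + 1) * exp (1 - \<eta> / (4 * \<beta>) * real n)"
            using \<eta>(2) by (intro mult_left_mono) (auto simp: L_def algebra_simps)
          finally show "measure_pmf.prob ?p {x. 2 * count x v \<le> size x}
            \<le> (real t + 1) * exp (1 - \<eta> / (4 * \<beta>) * real n)" .
        qed
      qed
    qed
  qed
qed (rule conn)

text \<open>The arcs are symmetric, so connectedness already yields directed paths.\<close>

lemma rtrancl_parcs:
  assumes "Digraph_Component.connected (with_proj G)" "i \<in> pverts G" "j \<in> pverts G"
  shows "(i, j) \<in> (parcs G)\<^sup>*"
proof -
  have "strongly_connected (with_proj G)"
    using assms(1) pair_sym_arcs by (intro symmetric_connected_imp_strongly_connected)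
  then have "i \<rightarrow>\<^sup>*\<^bsub>with_proj G\<^esub> j"
    using assms(2,3) by (auto simp: strongly_connected_def)
  then have "(i, j) \<in> rtrancl_on (pverts G) (parcs G)"
    by (simp add: reachable_def)
  then show ?thesis by (rule rtrancl_on_rtranclI)
qed

end

section \<open>Comparison of two metastable vertices\<close>

theorem theorem1:
  fixes G :: "'a pair_pre_digraph"
  assumes "pair_graph G" and "Digraph_Component.connected (with_proj G)"
    and "card (pverts G) \<ge> 2"
  shows "\<exists>\<beta>0 > 0. \<forall>\<beta> > \<beta>0. \<forall>\<epsilon>. 0 < \<epsilon> \<and> \<epsilon> < 1 / 2 \<longrightarrow>
           (\<exists>c > 0. \<forall>\<^sub>F n in sequentially.
              real (arw_mixing_time G \<beta> n \<epsilon>) \<ge> exp (c * real n))"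
proof -
  interpret pair_graph G by fact
  note conn = rtrancl_parcs[OF assms(2)]
  obtain v w where vw: "v \<in> pverts G" "w \<in> pverts G" "v \<noteq> w"
    using assms(3) by (metis One_nat_def card_le_Suc0_iff_eq not_less_eq_eq numeral_2_eq_2 pair_finite_verts)
  \<comment> \<open>The complements of \<open>A v\<close> and \<open>A w\<close> are the two wells:
    a strict majority of the particles sits at one vertex.\<close>
  define A where "A u = {x :: 'a multiset. 2 * count x u \<le> size x}" for u
  let ?prob = "\<lambda>\<beta> n t u. measure_pmf.prob (kernel_power (arw_kernel G \<beta>) t (replicate_mset n u)) (A u)"
  have meta: "\<exists>b. \<forall>\<beta>\<ge>b. \<exists>c>0. \<forall>\<^sub>F n in sequentially. \<forall>t. ?prob \<beta> n t u \<le> (real t + 1) * exp (1 - c * real n)"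
    if "u \<in> pverts G" for u
    unfolding A_def using that conn by (intro arw_metastable)
  obtain b1 where b1: "\<And>\<beta>. b1 \<le> \<beta> \<Longrightarrow> \<exists>c>0. \<forall>\<^sub>F n in sequentially. \<forall>t. ?prob \<beta> n t v \<le> (real t + 1) * exp (1 - c * real n)"
    using meta[OF vw(1)] by blast
  obtain b2 where b2: "\<And>\<beta>. b2 \<le> \<beta> \<Longrightarrow> \<exists>c>0. \<forall>\<^sub>F n in sequentially. \<forall>t. ?prob \<beta> n t w \<le> (real t + 1) * exp (1 - c * real n)"
    using meta[OF vw(2)] by blast
  show ?thesis
  proof (rule exI[of _ "max 1 (max b1 b2)"], intro conjI allI impI)
    fix \<beta> \<epsilon> :: real
    assume \<beta>: "max 1 (max b1 b2) < \<beta>" and "0 < \<epsilon> \<and> \<epsilon> < 1 / 2"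
    then have \<epsilon>: "0 < \<epsilon>" "\<epsilon> < 1 / 2" by auto
    obtain c1 where c1: "0 < c1" "\<forall>\<^sub>F n in sequentially. \<forall>t. ?prob \<beta> n t v \<le> (real t + 1) * exp (1 - c1 * real n)"
      using b1[of \<beta>] \<beta> by auto
    obtain c2 where c2: "0 < c2" "\<forall>\<^sub>F n in sequentially. \<forall>t. ?prob \<beta> n t w \<le> (real t + 1) * exp (1 - c2 * real n)"
      using b2[of \<beta>] \<beta> by auto
    define c where "c = min c1 c2"
    have c: "0 < c" "c \<le> c1" "c \<le> c2" using c1(1) c2(1) by (auto simp: c_def)
    have "0 < 1 / 2 - \<epsilon>" using \<epsilon> by simp
    \<comment> \<open>Half of the rate is given up to absorb the factor
      \<open>1 / 2 - \<epsilon>\<close>, the constant in the exponent and the 1 in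
      \<open>real t + 1\<close>.\<close>
    then have "\<forall>\<^sub>F n in sequentially. exp (c / 2 * real n) + 1 \<le> (1 / 2 - \<epsilon>) * exp (c * real n - 1)"
      using c(1) by real_asymp
    with c1(2) c2(2) have "\<forall>\<^sub>F n in sequentially. exp (c / 2 * real n) \<le> real (arw_mixing_time G \<beta> n \<epsilon>)"
      using eventually_gt_at_top[of 0]
    proof eventually_elim
      case (elim n)
      let ?S = "arw_configs G n"
      let ?K = "arw_kernel G \<beta>"
      let ?\<pi> = "stationary_dist ?S ?K"
      define t where "t = arw_mixing_time G \<beta> n \<epsilon>"
      have "\<exists>t. mixing_dist ?S ?K t \<le> \<epsilon>"
        using conn vw elim(4) \<epsilon>(1) by (intro ex_arw_mixing_dist_le) auto
      then have mix: "mixing_dist ?S ?K t \<le> \<epsilon>"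
        unfolding t_def arw_mixing_time_def mixing_time_def by (rule LeastI_ex)
      \<comment> \<open>At the mixing time the stationary distribution charges the well of
        \<open>u\<close> at least as much as the chain started there does, up to \<epsilon>.\<close>
      have lower: "1 - ?prob \<beta> n t u - \<epsilon> \<le> measure_pmf.prob ?\<pi> (- A u)" if "u \<in> pverts G" for u
      proof -
        let ?p = "kernel_power ?K t (replicate_mset n u)"
        have "finite ?S"
          using pair_finite_verts by (auto simp: arw_configs_def)
        moreover have "replicate_mset n u \<in> ?S"
          using that by (auto simp: arw_configs_def multisets_of_size_def)
        ultimately have "tv_dist ?p ?\<pi> \<le> mixing_dist ?S ?K t"
          unfolding mixing_dist_def by (intro Max_ge) auto
        then have "\<bar>measure_pmf.prob ?p (- A u) - measure_pmf.prob ?\<pi> (- A u)\<bar> \<le> \<epsilon>"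
          using mix abs_prob_diff_le_tv_dist[of ?p "- A u" ?\<pi>] by linarith
        moreover have "measure_pmf.prob ?p (- A u) = 1 - measure_pmf.prob ?p (A u)"
          using measure_pmf.prob_compl[of "A u" ?p] by (simp add: Compl_eq_Diff_UNIV)
        ultimately show ?thesis by linarith
      qed
      have "x \<in> A v \<or> x \<in> A w" for x
      proof -
        have "count x v + count x w \<le> size x"
          using vw(3) by (induction x) auto
        then show ?thesis unfolding A_def mem_Collect_eq by linarith
      qed
      then have "- A v \<inter> - A w = {}" by blast
      \<comment> \<open>The stationary masses of the disjoint wells sum to at most 1. Were both
        chains still in their wells, each mass would be close to \<open>1 - \<epsilon>\<close> or
        larger, hence above 1/2.\<close>
      then have "measure_pmf.prob ?\<pi> (- A v) + measure_pmf.prob ?\<pi> (- A w) = measure_pmf.prob ?\<pi> (- A v \<union> - A w)"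
        by (intro measure_pmf.finite_measure_Union[symmetric]) auto
      also have "\<dots> \<le> 1" by (rule measure_pmf.prob_le_1)
      finally have "1 - 2 * \<epsilon> \<le> ?prob \<beta> n t v + ?prob \<beta> n t w"
        using lower[OF vw(1)] lower[OF vw(2)] by linarith
      also have "\<dots> \<le> (real t + 1) * exp (1 - c1 * real n) + (real t + 1) * exp (1 - c2 * real n)"
        using elim(1,2) by (intro add_mono) auto
      also have "\<dots> \<le> (real t + 1) * exp (1 - c * real n) + (real t + 1) * exp (1 - c * real n)"
        using c by (intro add_mono mult_left_mono) (auto intro!: mult_right_mono)
      finally have "1 / 2 - \<epsilon> \<le> (real t + 1) * exp (1 - c * real n)" by simp
      then have "(1 / 2 - \<epsilon>) * exp (c * real n - 1) \<le> (real t + 1) * exp (1 - c * real n) * exp (c * real n - 1)"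
        by (intro mult_right_mono) auto
      also have "\<dots> = real t + 1" by (simp add: mult.assoc flip: exp_add)
      finally show ?case using elim(3) by (simp add: t_def)
    qed
    then show "\<exists>c>0. \<forall>\<^sub>F n in sequentially. exp (c * real n) \<le> real (arw_mixing_time G \<beta> n \<epsilon>)"
      using c(1) by (intro exI[of _ "c / 2"]) auto
  qed simp
qed

end
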